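(* Let $E$ be a real Banach space partially ordered by a cone $K$. Let $A\colon K\to K$ be a monotone operator, and let the cone $K$ be normal. Assume that there exist numbers $\sigma_0\in(0,1)$, $n_0\in\mathbb{N}$ and an element $v_0\in K$, $v_0\neq\theta$, such that $$\sigma_0 A^{n_0-1}v_0\le A^{n_0}v_0\le A^{n_0-1}v_0 .$$ If the operator $A$ is strongly concave on $K_1:=\langle\theta, A^{n_0-1}v_0\rangle\subset K$, then the following assertions hold: 1) there exists an element $x^*\in K$, $x^*\neq\theta$, such that $Ax^*=x^*$; 2) there exist numbers $C>0$ and $k\in(0,1)$ such that $\|A^n v_0-x^*\|\le Ck^n$ for all $n=n_0,n_0+1,\ldots$.
   Context: $E$ is a real Banach space with zero element $\theta$. A cone $K\subset E$ is a nonempty closed convex set with $tK\subset K$ for all $t\ge0$ and $K\cap(-K)=\{\theta\}$; it induces the partial order $x\le y \iff y-x\in K$. The cone $K$ is normal if there is $\delta>0$ such that $\|e_1+e_2\|\ge\delta$ for all $e_1,e_2\in K$ with $\|e_1\|=\|e_2\|=1$ (equivalently, there is $N>0$ such that $\theta\le x\le y$ implies $\|x\|\le N\|y\|$). For $u\le v$, the conical segment is $\langle u,v\rangle=\{x\in E: u\le x\le v\}$. An operator $A\colon K\to K$ is monotone if $x\le y$ implies $Ax\le Ay$; no continuity of $A$ is assumed. $A^n$ denotes the $n$-fold iterate, $A^0$ the identity, and $\mathbb{N}=\{1,2,\ldots\}$. A monotone operator $A$ is strongly concave on a subset $K_1\subseteq K$ if there exists a continuous and monotonically increasing concave mapping $\varphi\colon[0,1]\to[0,1]$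 with $\varphi(0)=0$, $\varphi(1)=1$, $\varphi'(+0)=+\infty$ such that $A(\sigma u)\ge\varphi(\sigma)Au$ for all $u\in K_1$, $\sigma\in[0,1]$.
   Formalization: The formal theorem additionally assumes A^{n_0-1}v_0 ≠ θ; without it the claim is false (E=ℝ, K=[0,∞), A=0, n_0=2, v_0=1), and whenever A^{n_0-1}v_0 = θ assertion 2) forces x*=θ, contradicting 1). *)

theory Defs
  imports "HOL-Analysis.Analysis"
begin

text \<open>
  Operators on a cone \<open>K\<close> are total functions on the whole space; every condition on them
  is relativised to \<open>K\<close>, and the theorem only uses their values on \<open>K\<close>.
\<close>

definition order_cone :: "'a::real_normed_vector set \<Rightarrow> bool" where
  "order_cone K \<longleftrightarrow> K \<noteq> {} \<and> closed K \<and> convex K \<and> cone K \<and> K \<inter> uminus ` K = {0}"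

definition cone_le :: "'a::real_normed_vector set \<Rightarrow> 'a \<Rightarrow> 'a \<Rightarrow> bool" where
  "cone_le K x y \<longleftrightarrow> y - x \<in> K"

definition normal_cone :: "'a::real_normed_vector set \<Rightarrow> bool" where
  "normal_cone K \<longleftrightarrow>
     (\<exists>\<delta>>0. \<forall>e1\<in>K. \<forall>e2\<in>K. norm e1 = 1 \<longrightarrow> norm e2 = 1 \<longrightarrow> norm (e1 + e2) \<ge> \<delta>)"

definition conical_segment :: "'a::real_normed_vector set \<Rightarrow> 'a \<Rightarrow> 'a \<Rightarrow> 'a set" where
  "conical_segment K u v = {x. cone_le K u x \<and> cone_le K x v}"

definition cone_monotone :: "'a::real_normed_vector set \<Rightarrow> ('a \<Rightarrow> 'a) \<Rightarrow> bool" where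
  "cone_monotone K A \<longleftrightarrow> monotone_on K (cone_le K) (cone_le K) A"

text \<open>
  The condition \<open>\<phi>'(+0) = +\<infinity>\<close> is read as divergence of the right difference quotient
  at \<open>0\<close>, and ``increasing'' is read in the weak sense.
\<close>

definition strongly_concave_on ::
  "'a::real_normed_vector set \<Rightarrow> ('a \<Rightarrow> 'a) \<Rightarrow> 'a set \<Rightarrow> bool" where
  "strongly_concave_on K A K\<^sub>1 \<longleftrightarrow>
     (\<exists>\<phi> :: real \<Rightarrow> real.
        \<phi> \<in> {0..1} \<rightarrow> {0..1} \<and> continuous_on {0..1} \<phi> \<and> mono_on {0..1} \<phi> \<and>
        concave_on {0..1} \<phi> \<and> \<phi> 0 = 0 \<and> \<phi> 1 = 1 \<and>
        filterlim (\<lambda>t. (\<phi> t - \<phi> 0) / (t - 0)) at_top (at_right 0) \<and>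
        (\<forall>u\<in>K\<^sub>1. \<forall>\<sigma>\<in>{0..1}. cone_le K (\<phi> \<sigma> *\<^sub>R A u) (A (\<sigma> *\<^sub>R u))))"

end

theory Submission
  imports Defs
begin

text \<open>
  Put \<open>w = A\<^bsup>n\<^sub>0-1\<^esup> v\<^sub>0\<close>, so that \<open>\<sigma>\<^sub>0 w \<le> A w \<le> w\<close>. The infinite slope of \<open>\<phi>\<close> at \<open>0\<close> provides
  some \<open>s \<in> (0,1)\<close> with \<open>\<sigma>\<^sub>0 \<phi>(s) \<ge> s\<close>, and then \<open>A (s w) \<ge> \<phi>(s) A w \<ge> \<phi>(s) \<sigma>\<^sub>0 w \<ge> s w\<close>: the
  element \<open>s w\<close> is a subsolution below the supersolution \<open>w\<close>. The iterates of \<open>s w\<close> therefore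
  increase, those of \<open>w\<close> decrease, and the former stay below the latter.

  The gap closes geometrically. Since \<open>\<phi>(s) > s\<close>, the chord of \<open>\<phi>\<close> over \<open>[s,1]\<close> has slope less
  than \<open>1\<close>, and concavity gives \<open>1 - \<phi>(t) \<le> k (1 - t)\<close> on \<open>[s,1]\<close> for some \<open>k < 1\<close>
  (\<open>concave_gap_to_one\<close>). Iterating, \<open>A\<^sup>n (s w) \<ge> (1 - k\<^sup>n (1 - s)) A\<^sup>n w\<close>
  (\<open>iterates_scaled_lower_bound\<close>), and \<open>A\<^sup>n w - A\<^sup>n (s w) \<le> k\<^sup>n (1 - s) w\<close> because
  \<open>A\<^sup>n w \<le> w\<close>. Normality turns this into a norm estimate (\<open>normal_cone_norm_bound\<close>), so both sequences converge to a common
  limit, squeezed between them. Monotonicity alone makes this limit a fixed point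
  (\<open>monotone_squeeze_fixed_point\<close>); it is nonzero because it lies above \<open>s w\<close>.
\<close>

section \<open>The order induced by a cone\<close>

lemma order_cone_add:
  assumes "order_cone K" "x \<in> K" "y \<in> K"
  shows "x + y \<in> K"
  using assms convex_cone[of K] unfolding order_cone_def by blast

lemma order_cone_scaleR:
  assumes "order_cone K" "x \<in> K" "0 \<le> c"
  shows "c *\<^sub>R x \<in> K"
  using assms by (auto simp: order_cone_def cone_def)

lemma order_cone_zero:
  assumes "order_cone K"
  shows "0 \<in> K"
  using assms by (auto simp: order_cone_def)

lemma cone_le_zero_iff: "cone_le K 0 x \<longleftrightarrow> x \<in> K"
  by (simp add: cone_le_def)

lemma cone_le_refl:
  assumes "order_cone K"
  shows "cone_le K x x"
  using order_cone_zero[OF assms] by (simp add: cone_le_def)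

lemma cone_le_trans:
  assumes "order_cone K" "cone_le K x y" "cone_le K y z"
  shows "cone_le K x z"
  using order_cone_add[of K "y - x" "z - y"] assms by (simp add: cone_le_def)

lemma cone_le_in_cone:
  assumes "order_cone K" "x \<in> K" "cone_le K x y"
  shows "y \<in> K"
  using cone_le_trans[of K 0 x y] assms by (simp add: cone_le_zero_iff)

lemma cone_le_scaleR:
  assumes "order_cone K" "cone_le K x y" "0 \<le> c"
  shows "cone_le K (c *\<^sub>R x) (c *\<^sub>R y)"
  using order_cone_scaleR[of K "y - x" c] assms
  by (simp add: cone_le_def scaleR_diff_right)

lemma cone_le_scaleR_left:
  assumes "order_cone K" "x \<in> K" "a \<le> b"
  shows "cone_le K (a *\<^sub>R x) (b *\<^sub>R x)"
  using order_cone_scaleR[of K x "b - a"] assms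
  by (simp add: cone_le_def scaleR_diff_left)

lemma order_cone_pointed:
  assumes "order_cone K" "x \<in> K" "- x \<in> K"
  shows "x = 0"
proof -
  have "x \<in> K \<inter> uminus ` K"
    using assms(2,3) by (auto intro: image_eqI[where x = "- x"])
  thus ?thesis using assms(1) by (auto simp: order_cone_def)
qed

lemma cone_le_limit_right:
  assumes "order_cone K" "X \<longlonglongrightarrow> x" "\<And>m. m \<ge> n \<Longrightarrow> cone_le K a (X m)"
  shows "cone_le K a x"
proof -
  have "closed K" using assms(1) by (simp add: order_cone_def)
  moreover have "(\<lambda>m. X m - a) \<longlonglongrightarrow> x - a" by (intro tendsto_intros assms(2))
  moreover have "\<forall>\<^sub>F m in sequentially. X m - a \<in> K"
    using assms(3) by (auto simp: eventually_sequentially cone_le_def)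
  ultimately show ?thesis
    unfolding cone_le_def by (metis Lim_in_closed_set sequentially_bot)
qed

lemma cone_le_limit_left:
  assumes "order_cone K" "X \<longlonglongrightarrow> x" "\<And>m. m \<ge> n \<Longrightarrow> cone_le K (X m) b"
  shows "cone_le K x b"
proof -
  have "cone_le K (- b) (- x)"
    using cone_le_limit_right[OF assms(1) tendsto_minus[OF assms(2)], of n "- b"] assms(3)
    by (simp add: cone_le_def)
  thus ?thesis by (simp add: cone_le_def)
qed

section \<open>Normality and the norm\<close>

text \<open>
  This is the passage from the angle form of normality to the monotonicity of the norm up to a
  factor. For \<open>y = x + z\<close> with \<open>x, z \<in> K\<close> nonzero, the two normalised vectors satisfy
  \<open>x/\<parallel>x\<parallel> + z/\<parallel>z\<parallel> = y/\<parallel>x\<parallel> + (\<parallel>x\<parallel> - \<parallel>z\<parallel>)/\<parallel>x\<parallel> \<cdot> z/\<parallel>z\<parallel>\<close>, and both terms on the right have norm at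
  most \<open>\<parallel>y\<parallel>/\<parallel>x\<parallel>\<close>; hence \<open>\<delta> \<le> 2 \<parallel>y\<parallel>/\<parallel>x\<parallel>\<close>.
\<close>

lemma normal_cone_norm_bound:
  assumes K: "order_cone K" and "normal_cone K"
  obtains N where "N > 0" "\<And>x y. x \<in> K \<Longrightarrow> cone_le K x y \<Longrightarrow> norm x \<le> N * norm y"
proof -
  from \<open>normal_cone K\<close> obtain \<delta> where "\<delta> > 0" and
    \<delta>: "\<And>e1 e2. e1 \<in> K \<Longrightarrow> e2 \<in> K \<Longrightarrow> norm e1 = 1 \<Longrightarrow> norm e2 = 1 \<Longrightarrow> norm (e1 + e2) \<ge> \<delta>"
    unfolding normal_cone_def by blast
  have "norm x \<le> (1 + 2 / \<delta>) * norm y" if x: "x \<in> K" and "cone_le K x y" for x y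
  proof -
    define z where "z = y - x"
    have z: "z \<in> K" using \<open>cone_le K x y\<close> by (simp add: z_def cone_le_def)
    have y: "y = x + z" by (simp add: z_def)
    have nonneg: "0 \<le> 2 / \<delta> * norm y" using \<open>\<delta> > 0\<close> by simp
    show ?thesis
    proof (cases "x = 0 \<or> z = 0")
      case True
      thus ?thesis using nonneg \<open>\<delta> > 0\<close> by (auto simp: y algebra_simps)
    next
      case False
      define e1 where "e1 = (1 / norm x) *\<^sub>R x"
      define e2 where "e2 = (1 / norm z) *\<^sub>R z"
      have e: "norm e1 = 1" "norm e2 = 1" "e1 \<in> K" "e2 \<in> K"
        using False x z K by (auto simp: e1_def e2_def intro!: order_cone_scaleR)
      have "norm x *\<^sub>R (e1 + e2) = y + (norm x - norm z) *\<^sub>R e2"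
        using False by (simp add: e1_def e2_def y algebra_simps)
      hence "norm (norm x *\<^sub>R (e1 + e2)) \<le> norm y + norm ((norm x - norm z) *\<^sub>R e2)"
        by (simp only: norm_triangle_ineq)
      hence "norm x * norm (e1 + e2) \<le> norm y + \<bar>norm x - norm z\<bar>"
        using e by simp
      also have "\<bar>norm x - norm z\<bar> \<le> norm y"
        using norm_triangle_ineq3[of x "- z"] by (simp add: y)
      finally have "norm x * norm (e1 + e2) \<le> 2 * norm y" by simp
      moreover have "norm x * \<delta> \<le> norm x * norm (e1 + e2)"
        by (intro mult_left_mono \<delta> e) simp
      ultimately have "norm x \<le> 2 / \<delta> * norm y"
        using \<open>\<delta> > 0\<close> by (simp add: field_simps)
      thus ?thesis by (simp add: algebra_simps add_increasing)
    qed
  qed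
  moreover have "1 + 2 / \<delta> > 0" using \<open>\<delta> > 0\<close> by (simp add: add_pos_pos)
  ultimately show ?thesis using that by blast
qed

section \<open>Iterates of monotone operators\<close>

lemma funpow_in_cone:
  assumes "A \<in> K \<rightarrow> K" "x \<in> K"
  shows "(A ^^ n) x \<in> K"
  using assms by (induction n) auto

lemma cone_monotoneD:
  assumes "cone_monotone K A" "x \<in> K" "y \<in> K" "cone_le K x y"
  shows "cone_le K (A x) (A y)"
  using assms by (auto simp: cone_monotone_def monotone_on_def)

lemma funpow_cone_mono:
  assumes "cone_monotone K A" "A \<in> K \<rightarrow> K" "x \<in> K" "y \<in> K" "cone_le K x y"
  shows "cone_le K ((A ^^ n) x) ((A ^^ n) y)"
proof (induction n)
  case (Suc n)
  show ?case
    using cone_monotoneD[OF assms(1) funpow_in_cone funpow_in_cone Suc.IH] assms(2-4) by simp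
qed (use assms in simp)

lemma funpow_subsolution_increasing:
  assumes "order_cone K" "cone_monotone K A" "A \<in> K \<rightarrow> K" "u \<in> K" "cone_le K u (A u)" "m \<le> n"
  shows "cone_le K ((A ^^ m) u) ((A ^^ n) u)"
  using \<open>m \<le> n\<close>
proof (induction n rule: dec_induct)
  case (step n)
  have "cone_le K ((A ^^ n) u) ((A ^^ n) (A u))"
    using assms by (intro funpow_cone_mono) auto
  hence "cone_le K ((A ^^ n) u) ((A ^^ Suc n) u)"
    by (simp add: funpow_swap1)
  thus ?case using step.IH cone_le_trans[OF \<open>order_cone K\<close>] by blast
qed (use assms in \<open>simp add: cone_le_refl\<close>)

lemma funpow_supersolution_decreasing:
  assumes "order_cone K" "cone_monotone K A" "A \<in> K \<rightarrow> K" "w \<in> K" "cone_le K (A w) w" "m \<le> n"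
  shows "cone_le K ((A ^^ n) w) ((A ^^ m) w)"
  using \<open>m \<le> n\<close>
proof (induction n rule: dec_induct)
  case (step n)
  have "cone_le K ((A ^^ n) (A w)) ((A ^^ n) w)"
    using assms by (intro funpow_cone_mono) auto
  hence "cone_le K ((A ^^ Suc n) w) ((A ^^ n) w)"
    by (simp add: funpow_swap1)
  thus ?case using step.IH cone_le_trans[OF \<open>order_cone K\<close>] by blast
qed (use assms in \<open>simp add: cone_le_refl\<close>)

text \<open>
  Monotonicity takes the place of continuity: the limit \<open>x\<close> of the upper iterates lies between the two sequences,
  so \<open>A x\<close> lies between the two shifted sequences, and the vanishing gap leaves room for one
  element only.
\<close>

lemma monotone_squeeze_fixed_point:
  fixes K :: "'a::banach set"
  assumes K: "order_cone K" and "normal_cone K"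
    and mono: "cone_monotone K A" and AK: "A \<in> K \<rightarrow> K"
    and u: "u \<in> K" "cone_le K u (A u)" and w: "w \<in> K" "cone_le K (A w) w"
    and uw: "cone_le K u w"
    and gap: "(\<lambda>n. (A ^^ n) w - (A ^^ n) u) \<longlonglongrightarrow> 0"
  obtains x where "A x = x"
    "\<And>n. cone_le K ((A ^^ n) u) x" "\<And>n. cone_le K x ((A ^^ n) w)"
proof -
  obtain N where "N > 0" and N: "\<And>x y. x \<in> K \<Longrightarrow> cone_le K x y \<Longrightarrow> norm x \<le> N * norm y"
    using normal_cone_norm_bound[OF K \<open>normal_cone K\<close>] by blast
  define U where "U n = (A ^^ n) u" for n
  define W where "W n = (A ^^ n) w" for n
  have gap': "(\<lambda>n. N * norm (W n - U n)) \<longlonglongrightarrow> 0"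
    using tendsto_mult_right_zero[OF tendsto_norm_zero[OF gap]] by (simp add: U_def W_def)
  have U_le_W: "cone_le K (U n) (W n)" for n
    unfolding U_def W_def using mono AK u w uw by (intro funpow_cone_mono) auto
  have U_mono: "cone_le K (U m) (U n)" if "m \<le> n" for m n
    unfolding U_def using that K mono AK u by (intro funpow_subsolution_increasing) auto
  have W_mono: "cone_le K (W n) (W m)" if "m \<le> n" for m n
    unfolding W_def using that K mono AK w by (intro funpow_supersolution_decreasing) auto
  have U_le_W': "cone_le K (U n) (W m)" if "n \<le> m" for m n
    using cone_le_trans[OF K U_mono[OF that] U_le_W] .
  have near: "norm (W n - y) \<le> N * norm (W n - U n)"
    if "cone_le K (U n) y" "cone_le K y (W n)" for n y
    using that by (intro N) (auto simp: cone_le_def)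
  have "Cauchy W"
  proof (rule metric_CauchyI)
    fix e :: real assume "e > 0"
    hence "\<forall>\<^sub>F n in sequentially. N * norm (W n - U n) < e / 2"
      using order_tendstoD(2)[OF gap', of "e / 2"] by simp
    then obtain M where M: "N * norm (W M - U M) < e / 2"
      by (auto simp: eventually_sequentially)
    have "dist (W M) (W m) < e / 2" if "m \<ge> M" for m
      using near[OF U_le_W'[OF that] W_mono[OF that]] M by (simp add: dist_norm)
    hence "dist (W m) (W n) < e" if "m \<ge> M" "n \<ge> M" for m n
      using that dist_triangle_half_r by blast
    thus "\<exists>M. \<forall>m\<ge>M. \<forall>n\<ge>M. dist (W m) (W n) < e" by blast
  qed
  then obtain x where x: "W \<longlonglongrightarrow> x" by (auto simp: Cauchy_convergent_iff convergent_def)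
  have Ux: "cone_le K (U n) x" for n
    using cone_le_limit_right[OF K x U_le_W'] .
  have xW: "cone_le K x (W n)" for n
    using cone_le_limit_left[OF K x W_mono] .
  have xK: "x \<in> K" using cone_le_in_cone[OF K u(1)] Ux[of 0] by (simp add: U_def)
  have UA: "cone_le K (U (Suc n)) (A x)" and AW: "cone_le K (A x) (W (Suc n))" for n
    using cone_monotoneD[OF mono _ xK Ux[of n]] cone_monotoneD[OF mono xK _ xW[of n]]
      funpow_in_cone[OF AK u(1), of n] funpow_in_cone[OF AK w(1), of n]
    by (auto simp: U_def W_def)
  have "(\<lambda>n. W (Suc n) - A x) \<longlonglongrightarrow> 0"
  proof (rule Lim_null_comparison)
    show "\<forall>\<^sub>F n in sequentially. norm (W (Suc n) - A x) \<le> N * norm (W (Suc n) - U (Suc n))"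
      using near[OF UA AW] by (intro always_eventually) simp
    show "(\<lambda>n. N * norm (W (Suc n) - U (Suc n))) \<longlonglongrightarrow> 0"
      using LIMSEQ_Suc[OF gap'] .
  qed
  hence "(\<lambda>n. W (Suc n)) \<longlonglongrightarrow> A x" by (simp add: LIM_zero_iff)
  hence "A x = x" using LIMSEQ_Suc[OF x] LIMSEQ_unique by blast
  thus ?thesis using that[of x] Ux xW by (simp add: U_def W_def)
qed

section \<open>Contraction of the gap by concavity\<close>

text \<open>
  The graph of a concave function lies above its chord over \<open>[s,1]\<close>.
\<close>

lemma concave_gap_to_one:
  fixes \<phi> :: "real \<Rightarrow> real"
  assumes conc: "concave_on {0..1} \<phi>" and "\<phi> 1 = 1"
    and "0 \<le> s" "s < 1" "s \<le> t" "t \<le> 1"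
  shows "1 - \<phi> t \<le> (1 - \<phi> s) / (1 - s) * (1 - t)"
proof -
  define a where "a = (1 - t) / (1 - s)"
  have a: "0 \<le> a" "a \<le> 1" using assms by (auto simp: a_def field_simps)
  have "a * (1 - s) = 1 - t" using \<open>s < 1\<close> by (simp add: a_def)
  hence t: "t = a * s + (1 - a) * 1" by (simp add: algebra_simps)
  have "\<phi> (a * s + (1 - a) * 1) \<ge> a * \<phi> s + (1 - a) * \<phi> 1"
    using concave_onD[OF conc, of "1 - a" s 1] a assms by simp
  hence "1 - \<phi> t \<le> a * (1 - \<phi> s)" unfolding t[symmetric] by (simp add: \<open>\<phi> 1 = 1\<close> algebra_simps)
  thus ?thesis by (simp add: a_def mult.commute)
qed

text \<open>
  Each application of \<open>A\<close> replaces the factor \<open>t = 1 - k\<^sup>n (1 - s)\<close> by \<open>\<phi>(t)\<close>, which is at least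
  \<open>1 - k (1 - t)\<close>, the factor with exponent \<open>n + 1\<close>.
\<close>

lemma iterates_scaled_lower_bound:
  assumes K: "order_cone K" and mono: "cone_monotone K A" and AK: "A \<in> K \<rightarrow> K"
    and w: "w \<in> K" "cone_le K (A w) w"
    and conc: "\<And>v t. v \<in> conical_segment K 0 w \<Longrightarrow> t \<in> {0..1} \<Longrightarrow>
                 cone_le K (\<phi> t *\<^sub>R A v) (A (t *\<^sub>R v))"
    and s: "0 \<le> s" "s \<le> 1" and k: "0 \<le> k" "k \<le> 1"
    and gap: "\<And>t. s \<le> t \<Longrightarrow> t \<le> 1 \<Longrightarrow> 1 - \<phi> t \<le> k * (1 - t)"
  shows "cone_le K ((1 - k ^ n * (1 - s)) *\<^sub>R (A ^^ n) w) ((A ^^ n) (s *\<^sub>R w))"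
proof (induction n)
  case 0
  show ?case using K by (simp add: cone_le_refl)
next
  case (Suc n)
  define W where "W = (A ^^ n) w"
  define U where "U = (A ^^ n) (s *\<^sub>R w)"
  define t where "t = 1 - k ^ n * (1 - s)"
  have "k ^ n * (1 - s) \<le> 1 * (1 - s)"
    using k s by (intro mult_right_mono power_le_one) auto
  hence t: "s \<le> t" "t \<le> 1" using k s by (auto simp: t_def)
  have W: "W \<in> K" "A W \<in> K" and U: "U \<in> K"
    using funpow_in_cone[OF AK w(1), of n] funpow_in_cone[OF AK w(1), of "Suc n"]
      funpow_in_cone[OF AK order_cone_scaleR[OF K w(1) s(1)], of n]
    by (auto simp: W_def U_def)
  have "W \<in> conical_segment K 0 w"
    using W funpow_supersolution_decreasing[OF K mono AK w, of 0 n]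
    by (simp add: conical_segment_def cone_le_zero_iff W_def)
  hence "cone_le K (\<phi> t *\<^sub>R A W) (A (t *\<^sub>R W))"
    using t s by (intro conc) auto
  moreover have "cone_le K ((1 - k * (1 - t)) *\<^sub>R A W) (\<phi> t *\<^sub>R A W)"
    using gap[OF t] by (intro cone_le_scaleR_left K W) simp
  moreover have "cone_le K (A (t *\<^sub>R W)) (A U)"
    using Suc.IH t s W U K mono
    by (intro cone_monotoneD[OF mono] order_cone_scaleR[OF K]) (auto simp: W_def U_def t_def)
  ultimately have "cone_le K ((1 - k * (1 - t)) *\<^sub>R A W) (A U)"
    using cone_le_trans[OF K] by blast
  moreover have "1 - k * (1 - t) = 1 - k ^ Suc n * (1 - s)" by (simp add: t_def)
  ultimately show ?case by (simp add: W_def U_def)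
qed

text \<open>
  The condition \<open>\<phi>'(+0) = +\<infinity>\<close> acts through this choice of \<open>s\<close>. With \<open>c = 1 / \<sigma>\<^sub>0\<close> it supplies the
  subsolution \<open>s w\<close>, and since \<open>c > 1\<close> it also supplies \<open>\<phi>(s) > s\<close>.
\<close>

lemma infinite_slope_at_zero:
  fixes \<phi> :: "real \<Rightarrow> real"
  assumes "filterlim (\<lambda>t. (\<phi> t - \<phi> 0) / (t - 0)) at_top (at_right 0)" and "\<phi> 0 = 0"
  obtains s where "0 < s" "s < 1" "c * s \<le> \<phi> s"
proof -
  have "\<forall>\<^sub>F t in at_right 0. c \<le> \<phi> t / t"
    using assms by (simp add: filterlim_at_top)
  moreover have "\<forall>\<^sub>F t in at_right (0::real). 0 < t \<and> t < 1"
    by (auto simp: eventually_at_right_field intro!: exI[of _ 1])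
  ultimately have "\<forall>\<^sub>F t in at_right 0. c \<le> \<phi> t / t \<and> 0 < t \<and> t < 1"
    by (rule eventually_conj)
  then obtain s where "c \<le> \<phi> s / s" "0 < s" "s < 1"
    using eventually_happens'[OF trivial_limit_at_right_real] by blast
  thus ?thesis using that[of s] by (simp add: field_simps)
qed

section \<open>The fixed point of a strongly concave operator\<close>

theorem theorem1:
  fixes K :: "'a::banach set" and A :: "'a \<Rightarrow> 'a" and \<sigma>\<^sub>0 :: real and n\<^sub>0 :: nat and v\<^sub>0 :: 'a
  assumes "order_cone K" and "normal_cone K"
    and "A \<in> K \<rightarrow> K" and "cone_monotone K A"
    and "0 < \<sigma>\<^sub>0" and "\<sigma>\<^sub>0 < 1" and "n\<^sub>0 \<ge> 1"
    and "v\<^sub>0 \<in> K" and "v\<^sub>0 \<noteq> 0"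
    and "(A ^^ (n\<^sub>0 - 1)) v\<^sub>0 \<noteq> 0"
    and "cone_le K (\<sigma>\<^sub>0 *\<^sub>R (A ^^ (n\<^sub>0 - 1)) v\<^sub>0) ((A ^^ n\<^sub>0) v\<^sub>0)"
    and "cone_le K ((A ^^ n\<^sub>0) v\<^sub>0) ((A ^^ (n\<^sub>0 - 1)) v\<^sub>0)"
    and "strongly_concave_on K A (conical_segment K 0 ((A ^^ (n\<^sub>0 - 1)) v\<^sub>0))"
  shows "\<exists>x\<in>K. x \<noteq> 0 \<and> A x = x \<and>
           (\<exists>C>0. \<exists>k. 0 < k \<and> k < 1 \<and> (\<forall>n\<ge>n\<^sub>0. norm ((A ^^ n) v\<^sub>0 - x) \<le> C * k ^ n))"
proof -
  note K = assms(1) and AK = assms(3) and mono = assms(4)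
  define w where "w = (A ^^ (n\<^sub>0 - 1)) v\<^sub>0"
  have shift: "(A ^^ n) v\<^sub>0 = (A ^^ (n - (n\<^sub>0 - 1))) w" if "n \<ge> n\<^sub>0 - 1" for n
  proof -
    have "(A ^^ n) v\<^sub>0 = (A ^^ ((n - (n\<^sub>0 - 1)) + (n\<^sub>0 - 1))) v\<^sub>0"
      by (simp only: le_add_diff_inverse2[OF that])
    thus ?thesis by (simp only: funpow_add comp_apply w_def)
  qed
  have "n\<^sub>0 - (n\<^sub>0 - 1) = 1" using \<open>n\<^sub>0 \<ge> 1\<close> by simp
  hence Aw: "(A ^^ n\<^sub>0) v\<^sub>0 = A w" using shift[of n\<^sub>0] by simp
  have w: "w \<in> K" "w \<noteq> 0" "cone_le K (\<sigma>\<^sub>0 *\<^sub>R w) (A w)" "cone_le K (A w) w"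
    using assms(10-12) funpow_in_cone[OF AK \<open>v\<^sub>0 \<in> K\<close>] unfolding Aw w_def by blast+
  from assms(13)[folded w_def] obtain \<phi> where \<phi>: "concave_on {0..1} \<phi>" "\<phi> 0 = 0" "\<phi> 1 = 1"
    "filterlim (\<lambda>t. (\<phi> t - \<phi> 0) / (t - 0)) at_top (at_right 0)" and
    conc: "\<And>v t. v \<in> conical_segment K 0 w \<Longrightarrow> t \<in> {0..1} \<Longrightarrow>
             cone_le K (\<phi> t *\<^sub>R A v) (A (t *\<^sub>R v))"
    unfolding strongly_concave_on_def by (elim exE conjE) (rule that, assumption+, blast)
  obtain s where s: "0 < s" "s < 1" and slope: "1 / \<sigma>\<^sub>0 * s \<le> \<phi> s"
    using infinite_slope_at_zero[OF \<phi>(4,2)] by blast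
  have sub: "s \<le> \<phi> s * \<sigma>\<^sub>0" using slope \<open>0 < \<sigma>\<^sub>0\<close> by (simp add: field_simps)
  have "s < 1 / \<sigma>\<^sub>0 * s" using s \<open>0 < \<sigma>\<^sub>0\<close> \<open>\<sigma>\<^sub>0 < 1\<close> by (simp add: field_simps)
  hence "s < \<phi> s" using slope by simp
  \<comment> \<open>The chord slope vanishes when \<open>\<phi>\<close> already equals \<open>1\<close> at \<open>s\<close>; the maximum keeps \<open>k\<close> positive.\<close>
  define k where "k = max (1 / 2) ((1 - \<phi> s) / (1 - s))"
  have k: "0 < k" "k < 1" using s \<open>s < \<phi> s\<close> by (auto simp: k_def field_simps)
  have gap: "1 - \<phi> t \<le> k * (1 - t)" if "s \<le> t" "t \<le> 1" for t
  proof -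
    have "1 - \<phi> t \<le> (1 - \<phi> s) / (1 - s) * (1 - t)"
      using that s \<phi> by (intro concave_gap_to_one) auto
    also have "\<dots> \<le> k * (1 - t)" using that by (intro mult_right_mono) (auto simp: k_def)
    finally show ?thesis .
  qed

  define u where "u = s *\<^sub>R w"
  have uK: "u \<in> K" using s w K by (auto simp: u_def intro: order_cone_scaleR)
  have uw: "cone_le K u w"
    using cone_le_scaleR_left[OF K w(1), of s 1] s by (simp add: u_def)
  have uAu: "cone_le K u (A u)"
  proof -
    have "cone_le K u ((\<phi> s * \<sigma>\<^sub>0) *\<^sub>R w)"
      unfolding u_def using sub by (intro cone_le_scaleR_left K w)
    moreover have "cone_le K (\<phi> s *\<^sub>R \<sigma>\<^sub>0 *\<^sub>R w) (\<phi> s *\<^sub>R A w)"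
      using s \<open>s < \<phi> s\<close> by (intro cone_le_scaleR K w) simp
    moreover have "cone_le K (\<phi> s *\<^sub>R A w) (A u)"
      unfolding u_def using s w K
      by (intro conc) (auto simp: conical_segment_def cone_le_zero_iff cone_le_refl)
    ultimately show ?thesis using cone_le_trans[OF K] by (metis scaleR_scaleR)
  qed

  obtain N where "N > 0" and N: "\<And>x y. x \<in> K \<Longrightarrow> cone_le K x y \<Longrightarrow> norm x \<le> N * norm y"
    using normal_cone_norm_bound[OF K assms(2)] by blast
  define D where "D = N * ((1 - s) * norm w)"
  have "D > 0" using \<open>N > 0\<close> s w by (simp add: D_def)
  have close: "norm ((A ^^ n) w - x) \<le> D * k ^ n"
    if "cone_le K ((A ^^ n) u) x" "cone_le K x ((A ^^ n) w)" for x n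
  proof -
    define c where "c = k ^ n * (1 - s)"
    have "c \<ge> 0" using k s by (simp add: c_def)
    have "cone_le K ((1 - c) *\<^sub>R (A ^^ n) w) ((A ^^ n) u)"
      using iterates_scaled_lower_bound[where s = s and k = k and \<phi> = \<phi> and n = n,
          OF K mono AK w(1,4) conc _ _ _ _ gap] s k
      by (simp add: u_def c_def)
    hence "cone_le K ((1 - c) *\<^sub>R (A ^^ n) w) x"
      using that(1) cone_le_trans[OF K] by blast
    hence "cone_le K ((A ^^ n) w - x) (c *\<^sub>R (A ^^ n) w)"
      by (simp add: cone_le_def algebra_simps)
    moreover have "cone_le K (c *\<^sub>R (A ^^ n) w) (c *\<^sub>R w)"
      using funpow_supersolution_decreasing[OF K mono AK w(1,4), of 0 n] \<open>c \<ge> 0\<close>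
      by (intro cone_le_scaleR K) auto
    ultimately have "cone_le K ((A ^^ n) w - x) (c *\<^sub>R w)"
      using cone_le_trans[OF K] by blast
    hence "norm ((A ^^ n) w - x) \<le> N * norm (c *\<^sub>R w)"
      using that(2) by (intro N) (auto simp: cone_le_def)
    also have "\<dots> = D * k ^ n" using k s by (simp add: D_def c_def abs_mult)
    finally show ?thesis .
  qed

  have "(\<lambda>n. (A ^^ n) w - (A ^^ n) u) \<longlonglongrightarrow> 0"
  proof (rule Lim_null_comparison)
    show "\<forall>\<^sub>F n in sequentially. norm ((A ^^ n) w - (A ^^ n) u) \<le> D * k ^ n"
      using funpow_cone_mono[OF mono AK uK w(1) uw]
      by (intro always_eventually allI close) (auto intro: cone_le_refl K)
    show "(\<lambda>n. D * k ^ n) \<longlonglongrightarrow> 0"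
      using k by (intro tendsto_mult_right_zero LIMSEQ_power_zero) auto
  qed
  then obtain x where x: "A x = x"
    "\<And>n. cone_le K ((A ^^ n) u) x" "\<And>n. cone_le K x ((A ^^ n) w)"
    using monotone_squeeze_fixed_point[OF K assms(2) mono AK uK uAu w(1,4) uw] by blast
  have ux: "cone_le K u x" using x(2)[of 0] by simp
  have "x \<in> K" using cone_le_in_cone[OF K uK ux] .
  have "x \<noteq> 0"
  proof
    assume "x = 0"
    hence "u = 0" using ux uK order_cone_pointed[OF K] by (simp add: cone_le_def)
    thus False using s w by (simp add: u_def)
  qed
  have "norm ((A ^^ n) v\<^sub>0 - x) \<le> D / k ^ (n\<^sub>0 - 1) * k ^ n" if "n \<ge> n\<^sub>0" for n
  proof -
    have "norm ((A ^^ n) v\<^sub>0 - x) \<le> D * k ^ (n - (n\<^sub>0 - 1))"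
      using close[OF x(2,3)] shift[of n] that by simp
    also have "\<dots> = D / k ^ (n\<^sub>0 - 1) * k ^ n"
      using that k by (simp add: power_diff)
    finally show ?thesis .
  qed
  moreover have "D / k ^ (n\<^sub>0 - 1) > 0" using \<open>D > 0\<close> k by simp
  ultimately show ?thesis using \<open>x \<in> K\<close> \<open>x \<noteq> 0\<close> x(1) k by blast
qed

end
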